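(* Let $L>0$, and let $\bar\rho>0$, $\bar v>0$, $\bar\theta>0$, $R>0$, $c_v>0$, $\kappa>0$, $\mu>0$, $\lambda$ be constants with $\lambda+\mu\ge0$. Let $\mathcal{O}_1=(l_1,l_2)$ be a proper subinterval of $(0,L)$ and let $\mathcal{O}_2\subseteq(0,L)$, $\mathcal{O}_3\subseteq(0,L)$ be open. Consider the control system \[ \begin{aligned} &\rho_t+\bar v\rho_x+\bar\rho\,u_x=f\chi_{\mathcal{O}_1},\\ &u_t-\tfrac{\lambda+2\mu}{\bar\rho}u_{xx}+\tfrac{R\bar\theta}{\bar\rho}\rho_x+\bar v u_x+R\theta_x=g\chi_{\mathcal{O}_2},\\ &\theta_t-\tfrac{\kappa}{\bar\rho c_v}\theta_{xx}+\tfrac{R\bar\theta}{c_v}u_x+\bar v\theta_x=h\chi_{\mathcal{O}_3}, \end{aligned} \quad\text{in }(0,L)\times(0,T), \] with $\rho(0)=\rho_0$, $u(0)=u_0$, $\theta(0)=\theta_0$ in $(0,L)$ and $\rho(0,t)=0$, $u(0,t)=u(L,t)=0$, $\theta(0,t)=\theta(L,t)=0$ for $t\in(0,T)$. If $T<\max\{l_1/\bar v,(L-l_2)/\bar v\}$, then this system is not null controllable in time $T$ for initial data in $L^2(0,L)^3$ with controls $f\in L^2(0,T;L^2(\mathcal{O}_1))$, $g\in L^2(0,T;L^2(\mathcal{O}_2))$, $h\in L^2(0,T;L^2(\mathcal{O}_3))$; that is, it is not true that for every $(\rho_0,u_0,\theta_0)\in L^2(0,L)^3$ there exist such controls with $(\rho,u,\theta)(\cdot,T)=0$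 in $(0,L)$.
   Context: $\chi_{\mathcal{O}_i}$ denotes the characteristic function of $\mathcal{O}_i$. The system is the linearization of the one-dimensional compressible non-barotropic Navier–Stokes system around the constant state $(\bar\rho,\bar v,\bar\theta)$. *)

theory Defs
  imports "HOL-Analysis.Analysis"
begin

definition L2_on :: "'a::euclidean_space set \<Rightarrow> ('a \<Rightarrow> real) \<Rightarrow> bool" where
  "L2_on S f \<longleftrightarrow> f \<in> borel_measurable lborel \<and> set_integrable lborel S (\<lambda>z. (f z)^2)"

definition test_fun ::
  "(real \<times> real \<Rightarrow> real) \<Rightarrow> (real \<times> real \<Rightarrow> real) \<Rightarrow> (real \<times> real \<Rightarrow> real) \<Rightarrow> (real \<times> real \<Rightarrow> real) \<Rightarrow> bool" where
  "test_fun p pt px pxx \<longleftrightarrow>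
     continuous_on UNIV p \<and> continuous_on UNIV pt \<and> continuous_on UNIV px \<and> continuous_on UNIV pxx \<and>
     (\<forall>x t. ((\<lambda>s. p (s, t)) has_real_derivative px (x, t)) (at x) \<and>
            ((\<lambda>s. px (s, t)) has_real_derivative pxx (x, t)) (at x) \<and>
            ((\<lambda>s. p (x, s)) has_real_derivative pt (x, t)) (at t))"

text \<open>Weak (transposition) formulation of the linearized system on (0,L) x (0,T), with
  initial data (rho0,u0,theta0), controls f,g,h acting on O1,O2,O3, boundary conditions
  rho(0,t)=0, u=theta=0 at x=0,L, and final state (rho,u,theta)(.,T) = 0.
  The boundary and final conditions are encoded through the admissible test functions:
  the terminal term vanishes for test functions that are arbitrary at t = T.\<close>

definition weak_null_solution ::
  "real \<Rightarrow> real \<Rightarrow> real \<Rightarrow> real \<Rightarrow> real \<Rightarrow> real \<Rightarrow> real \<Rightarrow> real \<Rightarrow> real \<Rightarrow>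
   real set \<Rightarrow> real set \<Rightarrow> real set \<Rightarrow> real \<Rightarrow>
   (real \<Rightarrow> real) \<Rightarrow> (real \<Rightarrow> real) \<Rightarrow> (real \<Rightarrow> real) \<Rightarrow>
   (real \<times> real \<Rightarrow> real) \<Rightarrow> (real \<times> real \<Rightarrow> real) \<Rightarrow> (real \<times> real \<Rightarrow> real) \<Rightarrow>
   (real \<times> real \<Rightarrow> real) \<Rightarrow> (real \<times> real \<Rightarrow> real) \<Rightarrow> (real \<times> real \<Rightarrow> real) \<Rightarrow> bool" where
  "weak_null_solution L rb vb thb R cv kap mu lam O1 O2 O3 T rho0 u0 th0 f g h rho u th \<longleftrightarrow>
    (let Q = {0<..<L} \<times> {0<..<T} in
     (\<forall>p pt px pxx. test_fun p pt px pxx \<and> (\<forall>t. p (L, t) = 0) \<longrightarrow>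
        set_lebesgue_integral lborel Q (\<lambda>(x,t).
            rho (x,t) * (pt (x,t) + vb * px (x,t)) + rb * u (x,t) * px (x,t)
            + indicator O1 x * f (x,t) * p (x,t))
        + set_lebesgue_integral lborel {0<..<L} (\<lambda>x. rho0 x * p (x, 0)) = 0) \<and>
     (\<forall>p pt px pxx. test_fun p pt px pxx \<and> (\<forall>t. p (0, t) = 0 \<and> p (L, t) = 0) \<longrightarrow>
        set_lebesgue_integral lborel Q (\<lambda>(x,t).
            u (x,t) * (pt (x,t) + ((lam + 2 * mu) / rb) * pxx (x,t) + vb * px (x,t))
            + (R * thb / rb) * rho (x,t) * px (x,t) + R * th (x,t) * px (x,t)
            + indicator O2 x * g (x,t) * p (x,t))
        + set_lebesgue_integral lborel {0<..<L} (\<lambda>x. u0 x * p (x, 0)) = 0) \<and>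
     (\<forall>p pt px pxx. test_fun p pt px pxx \<and> (\<forall>t. p (0, t) = 0 \<and> p (L, t) = 0) \<longrightarrow>
        set_lebesgue_integral lborel Q (\<lambda>(x,t).
            th (x,t) * (pt (x,t) + (kap / (rb * cv)) * pxx (x,t) + vb * px (x,t))
            + (R * thb / cv) * u (x,t) * px (x,t)
            + indicator O3 x * h (x,t) * p (x,t))
        + set_lebesgue_integral lborel {0<..<L} (\<lambda>x. th0 x * p (x, 0)) = 0))"

definition null_controllable ::
  "real \<Rightarrow> real \<Rightarrow> real \<Rightarrow> real \<Rightarrow> real \<Rightarrow> real \<Rightarrow> real \<Rightarrow> real \<Rightarrow> real \<Rightarrow>
   real set \<Rightarrow> real set \<Rightarrow> real set \<Rightarrow> real \<Rightarrow> bool" where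
  "null_controllable L rb vb thb R cv kap mu lam O1 O2 O3 T \<longleftrightarrow>
    (\<forall>rho0 u0 th0. L2_on {0<..<L} rho0 \<and> L2_on {0<..<L} u0 \<and> L2_on {0<..<L} th0 \<longrightarrow>
      (\<exists>f g h. L2_on (O1 \<times> {0<..<T}) f \<and> L2_on (O2 \<times> {0<..<T}) g \<and> L2_on (O3 \<times> {0<..<T}) h \<and>
        (\<exists>rho u th. L2_on ({0<..<L} \<times> {0<..<T}) rho \<and> L2_on ({0<..<L} \<times> {0<..<T}) u \<and>
                    L2_on ({0<..<L} \<times> {0<..<T}) th \<and>
          weak_null_solution L rb vb thb R cv kap mu lam O1 O2 O3 T rho0 u0 th0 f g h rho u th)))"

end

theory Submission
  imports Defs
begin

text \<open>
  If the initial density jumps at a point whose characteristic \<open>x - vb t = x0\<close> stays inside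
  \<open>(0,L) \<setminus> O1\<close> up to time \<open>T\<close>, the jump survives, whatever the controls do. Let
  \<open>\<nu> = (lam + 2 mu) / rb\<close>, \<open>k = kap / (rb cv)\<close> and \<open>a = R thb / \<nu>\<close>.
  For a bump \<open>S\<close> supported near \<open>x0\<close>, the three weak equations are tested with the travelling waves
  \<open>p = \<nu> k / (rb R) e\<^bsup>at\<^esup> S''(x - vb t)\<close>, \<open>q = - k / R e\<^bsup>at\<^esup> S'(x - vb t)\<close>, \<open>r = e\<^bsup>at\<^esup> S(x - vb t)\<close>.
  The coefficients are chosen so that in the sum all terms with second and third derivatives of \<open>S\<close>
  cancel, and \<open>f\<close> drops out because \<open>p\<close> vanishes on \<open>O1\<close>. What is left bounds
  \<open>\<integral> \<rho>\<^sub>0 S''\<close> by integrals of fixed \<open>L\<^sup>2\<close> functions against \<open>S\<close> and \<open>S'\<close>. For the step function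
  \<open>\<rho>\<^sub>0 = 1\<close> on \<open>x \<le> x0\<close> the left-hand side is \<open>S'(x0)\<close>. Taking
  \<open>S(x) = \<epsilon> B((x - x0) / \<epsilon>)\<close> keeps \<open>S'(x0) = 1\<close>, while the other integrals tend to 0 with \<open>\<epsilon>\<close>.
\<close>

section \<open>Bumps and cutoffs of finite smoothness\<close>

text \<open>Only x = 0 needs an argument: there the difference quotient is dominated by
  \<open>max 0 h ^ n\<close>, which tends to 0 because \<open>n > 0\<close>. Powers of positive
  parts give compactly supported functions with as many continuous derivatives as the test functions
  require.\<close>

lemma has_real_derivative_pos_part_power:
  fixes x :: real
  assumes "n > 0"
  shows "((\<lambda>s. max 0 s ^ Suc n) has_real_derivative real (Suc n) * max 0 x ^ n) (at x)"
proof -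
  consider "x < 0" | "x > 0" | "x = 0" by linarith
  then show ?thesis
  proof cases
    case 1
    have "((\<lambda>s. 0) has_real_derivative real (Suc n) * max 0 x ^ n) (at x)"
      using 1 assms by (simp add: max_def zero_power)
    then show ?thesis
      by (rule has_field_derivative_transform_within_open[where S = "{..<0}"])
        (use 1 in \<open>auto simp: max_def\<close>)
  next
    case 2
    have "((\<lambda>s. s ^ Suc n) has_real_derivative real (Suc n) * max 0 x ^ n) (at x)"
      using 2 by (auto intro!: derivative_eq_intros simp del: power_Suc simp: max_def)
    then show ?thesis
      by (rule has_field_derivative_transform_within_open[where S = "{0<..}"])
        (use 2 in \<open>auto simp: max_def\<close>)
  next
    case 3
    have "((\<lambda>h. max 0 h ^ n) \<longlongrightarrow> max 0 0 ^ n) (at (0::real))"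
      by (intro tendsto_intros)
    then have lim: "((\<lambda>h::real. max 0 h ^ n) \<longlongrightarrow> 0) (at 0)"
      using assms by (metis max.idem zero_power)
    have "((\<lambda>h::real. max 0 h ^ Suc n / h) \<longlongrightarrow> 0) (at 0)"
      by (rule Lim_null_comparison[OF _ lim])
        (auto simp: eventually_at max_def intro!: exI[of _ 1])
    then show ?thesis
      using 3 assms by (simp add: DERIV_def zero_power)
  qed
qed

text \<open>The witness is B(x) = x max(0, 1 - x^2)^6. Each derivative lowers the exponent by at
  most one, so the fourth still carries the factor \<open>m 2\<close> and is continuous, while the
  factor x gives B'(0) = 1. Four derivatives are needed because one test function has profile S''
  and is itself differentiated twice in space.\<close>

lemma exists_C4_odd_bump:
  obtains B B1 B2 B3 B4 :: "real \<Rightarrow> real"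
  where "\<And>x. (B has_real_derivative B1 x) (at x)" "\<And>x. (B1 has_real_derivative B2 x) (at x)"
    "\<And>x. (B2 has_real_derivative B3 x) (at x)" "\<And>x. (B3 has_real_derivative B4 x) (at x)"
    "continuous_on UNIV B4"
    "\<And>x. \<bar>x\<bar> \<ge> 1 \<Longrightarrow> B x = 0 \<and> B1 x = 0 \<and> B2 x = 0 \<and> B3 x = 0 \<and> B4 x = 0"
    "B1 0 = 1"
proof -
  define m where "m n x = max 0 (1 - x\<^sup>2) ^ n" for n and x :: real
  have m_deriv: "(m (Suc n) has_real_derivative - 2 * real (Suc n) * x * m n x) (at x)"
    if "n > 0" for n x
  proof -
    have "((\<lambda>s. max 0 s ^ Suc n) has_real_derivative real (Suc n) * max 0 (1 - x\<^sup>2) ^ n)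
        (at (1 - x\<^sup>2))"
      by (rule has_real_derivative_pos_part_power[OF that])
    moreover have "((\<lambda>x. 1 - x\<^sup>2) has_real_derivative - 2 * x) (at x)"
      by (auto intro!: derivative_eq_intros)
    ultimately have "((\<lambda>x. max 0 (1 - x\<^sup>2) ^ Suc n) has_real_derivative
        real (Suc n) * max 0 (1 - x\<^sup>2) ^ n * (- 2 * x)) (at x)"
      by (rule DERIV_chain2)
    moreover have "m (Suc n) = (\<lambda>x. max 0 (1 - x\<^sup>2) ^ Suc n)"
      by (auto simp: m_def)
    ultimately show ?thesis by (simp add: m_def algebra_simps)
  qed
  have m_d: "(m 6 has_real_derivative - 12 * x * m 5 x) (at x)"
    "(m 5 has_real_derivative - 10 * x * m 4 x) (at x)"
    "(m 4 has_real_derivative - 8 * x * m 3 x) (at x)"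
    "(m 3 has_real_derivative - 6 * x * m 2 x) (at x)" for x
    using m_deriv[of 5 x] m_deriv[of 4 x] m_deriv[of 3 x] m_deriv[of 2 x]
    by (simp_all add: eval_nat_numeral)
  have m_zero: "m n x = 0" if "\<bar>x\<bar> \<ge> 1" "n > 0" for n x
  proof -
    have "1 \<le> x\<^sup>2" using that(1) by (metis abs_1 abs_le_square_iff one_power2)
    then show ?thesis using that(2) by (simp add: m_def max_def)
  qed
  show thesis
  proof
    show "((\<lambda>x. x * m 6 x) has_real_derivative m 6 x - 12 * x^2 * m 5 x) (at x)"
      "((\<lambda>x. m 6 x - 12 * x^2 * m 5 x) has_real_derivative
        - 36 * x * m 5 x + 120 * x^3 * m 4 x) (at x)"
      "((\<lambda>x. - 36 * x * m 5 x + 120 * x^3 * m 4 x) has_real_derivative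
        - 36 * m 5 x + 720 * x^2 * m 4 x - 960 * x^4 * m 3 x) (at x)"
      "((\<lambda>x. - 36 * m 5 x + 720 * x^2 * m 4 x - 960 * x^4 * m 3 x) has_real_derivative
        1800 * x * m 4 x - 9600 * x^3 * m 3 x + 5760 * x^5 * m 2 x) (at x)" for x
      by (rule derivative_eq_intros m_d refl | simp add: algebra_simps eval_nat_numeral)+
    show "continuous_on UNIV (\<lambda>x. 1800 * x * m 4 x - 9600 * x^3 * m 3 x + 5760 * x^5 * m 2 x)"
      unfolding m_def by (intro continuous_intros)
  qed (auto simp: m_zero, simp add: m_def)
qed

text \<open>The function \<open>y\<close> is 1 on [0,T], decreases quadratically outside, and is at
  most 0 at distance d or more from [0,T]. The square of its positive part is C^1, which matches the
  single time derivative in \<open>test_fun\<close>.\<close>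

lemma exists_C1_cutoff:
  fixes T d :: real
  assumes "d > 0" "T > 0"
  obtains c c' :: "real \<Rightarrow> real"
  where "\<And>t. (c has_real_derivative c' t) (at t)" "continuous_on UNIV c'"
    "\<And>t. 0 \<le> t \<Longrightarrow> t \<le> T \<Longrightarrow> c t = 1 \<and> c' t = 0"
    "\<And>t. t \<le> - d \<or> T + d \<le> t \<Longrightarrow> c t = 0"
proof -
  have pos2: "((\<lambda>s. (max 0 s)\<^sup>2) has_real_derivative 2 * max 0 x) (at x)" for x :: real
    using has_real_derivative_pos_part_power[of 1 x] by (simp add: eval_nat_numeral)
  define y where "y t = 1 - (max 0 (- t))\<^sup>2 / d\<^sup>2 - (max 0 (t - T))\<^sup>2 / d\<^sup>2" for t
  define y' where "y' t = (2 * max 0 (- t) - 2 * max 0 (t - T)) / d\<^sup>2" for t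
  have y_deriv: "(y has_real_derivative y' t) (at t)" for t
  proof -
    have 1: "((\<lambda>t. (max 0 (- t))\<^sup>2) has_real_derivative 2 * max 0 (- t) * (- 1)) (at t)"
      by (rule DERIV_chain2[OF pos2]) (auto intro!: derivative_eq_intros)
    have 2: "((\<lambda>t. (max 0 (t - T))\<^sup>2) has_real_derivative 2 * max 0 (t - T) * 1) (at t)"
      by (rule DERIV_chain2[OF pos2]) (auto intro!: derivative_eq_intros)
    show ?thesis
      unfolding y_def[abs_def] y'_def
      by (rule DERIV_cong, rule DERIV_diff[OF DERIV_diff[OF DERIV_const DERIV_cdivide[OF 1]]
              DERIV_cdivide[OF 2]]) (simp add: diff_divide_distrib)
  qed
  show thesis
  proof
    show "((\<lambda>t. (max 0 (y t))\<^sup>2) has_real_derivative 2 * max 0 (y t) * y' t) (at t)" for t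
      by (rule DERIV_chain2[OF pos2 y_deriv])
    show "continuous_on UNIV (\<lambda>t. 2 * max 0 (y t) * y' t)"
      unfolding y_def y'_def by (intro continuous_intros) (use assms in auto)
    show "(max 0 (y t))\<^sup>2 = 1 \<and> 2 * max 0 (y t) * y' t = 0" if "0 \<le> t" "t \<le> T" for t
      using that by (simp add: y_def y'_def max_def)
    show "(max 0 (y t))\<^sup>2 = 0" if "t \<le> - d \<or> T + d \<le> t" for t
    proof -
      have sq: "1 \<le> s\<^sup>2 / d\<^sup>2" if "d \<le> s" for s
        using that assms by (simp add: power_mono)
      have "y t \<le> 0"
      proof (cases "t \<le> - d")
        case True
        then show ?thesis using sq[of "- t"] assms by (simp add: y_def max_def)
      next
        case False
        then show ?thesis using that sq[of "t - T"] assms by (simp add: y_def max_def)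
      qed
      then show ?thesis by (simp add: max_def)
    qed
  qed
qed

section \<open>Travelling waves as test functions\<close>

text \<open>The wave moves with the speed of the transport term, so in p_t + v p_x the derivatives
  of the profile cancel. Where c = 1 and c' = 0, this operator is multiplication by a.\<close>

lemma test_fun_travelling_wave:
  assumes c: "\<And>t. (c has_real_derivative c' t) (at t)" "continuous_on UNIV c'"
    and P: "\<And>x. (P has_real_derivative P1 x) (at x)" "\<And>x. (P1 has_real_derivative P2 x) (at x)"
      "continuous_on UNIV P2"
  shows "test_fun (\<lambda>(x,t). K * c t * exp (a * t) * P (x - v * t))
    (\<lambda>(x,t). K * exp (a * t) * ((c' t + a * c t) * P (x - v * t) - v * c t * P1 (x - v * t)))
    (\<lambda>(x,t). K * c t * exp (a * t) * P1 (x - v * t))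
    (\<lambda>(x,t). K * c t * exp (a * t) * P2 (x - v * t))"
proof -
  have cont: "continuous_on UNIV P" "continuous_on UNIV P1" "continuous_on UNIV c"
    using P c by (meson DERIV_isCont continuous_at_imp_continuous_on)+
  have comp: "continuous_on UNIV (\<lambda>z. f (fst z - v * snd z))" "continuous_on UNIV (\<lambda>z. f (snd z))"
    if "continuous_on UNIV f" for f :: "real \<Rightarrow> real"
    by (auto intro!: continuous_on_compose2[OF that] continuous_intros)
  have dx: "((\<lambda>s. K * c t * exp (a * t) * f (s - v * t)) has_real_derivative
      K * c t * exp (a * t) * f' (x - v * t)) (at x)"
    if "\<And>x. (f has_real_derivative f' x) (at x)" for f f' :: "real \<Rightarrow> real" and x t
  proof -
    have "((\<lambda>s. f (s - v * t)) has_real_derivative f' (x - v * t) * 1) (at x)"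
      by (rule DERIV_chain2[OF that]) (auto intro!: derivative_eq_intros)
    then show ?thesis using DERIV_cmult by fastforce
  qed
  have dt: "((\<lambda>s. K * c s * exp (a * s) * P (x - v * s)) has_real_derivative
      K * exp (a * t) * ((c' t + a * c t) * P (x - v * t) - v * c t * P1 (x - v * t))) (at t)" for x t
  proof -
    have 1: "((\<lambda>s. P (x - v * s)) has_real_derivative P1 (x - v * t) * (- v)) (at t)"
      by (rule DERIV_chain2[OF P(1)]) (auto intro!: derivative_eq_intros)
    have 2: "((\<lambda>s. exp (a * s)) has_real_derivative exp (a * t) * a) (at t)"
      by (auto intro!: derivative_eq_intros)
    show ?thesis
      by (rule DERIV_cong, rule DERIV_mult[OF DERIV_mult[OF DERIV_cmult[OF c(1)] 2] 1])
        (simp add: algebra_simps)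
  qed
  show ?thesis
    unfolding test_fun_def case_prod_beta
    by (intro conjI allI continuous_intros comp cont c P)
      (simp_all add: dx[OF P(1)] dx[OF P(2)] dt)
qed

section \<open>Integrability of products\<close>

text \<open>On the compact closure of S the weight is bounded by some C. Since |f| \<le> 1 + f^2,
  the product is dominated by C (1 + f^2), which is integrable as S has finite measure.\<close>

lemma L2_on_times_continuous_integrable:
  fixes f w :: "'a::euclidean_space \<Rightarrow> real"
  assumes "L2_on S f" "continuous_on UNIV w" "bounded S" "S \<in> sets borel"
  shows "set_integrable lborel S (\<lambda>z. f z * w z)"
proof -
  have "compact (w ` closure S)"
    using assms by (intro compact_continuous_image continuous_on_subset[OF assms(2)])
      (auto simp: compact_closure)
  then obtain C where C: "\<And>z. z \<in> closure S \<Longrightarrow> \<bar>w z\<bar> \<le> C"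
    by (force dest!: compact_imp_bounded simp: bounded_iff)
  have fin: "emeasure lborel S < \<infinity>"
    using assms(3) emeasure_bounded_finite by blast
  have f: "f \<in> borel_measurable borel" and w: "w \<in> borel_measurable borel"
    using assms by (auto simp: L2_on_def borel_measurable_continuous_onI)
  have "set_integrable lborel S (\<lambda>z. C * (1 + (f z)\<^sup>2))"
    using assms(1,4) fin unfolding L2_on_def
    by (intro set_integrable_mult_right set_integral_add) (auto simp: set_integrable_def)
  then show ?thesis
    unfolding set_integrable_def
  proof (rule Bochner_Integration.integrable_bound)
    show "(\<lambda>x. indicat_real S x *\<^sub>R (f x * w x)) \<in> borel_measurable lborel"
      using f w assms(4) by simp
    have "\<bar>f z * w z\<bar> \<le> \<bar>C * (1 + (f z)\<^sup>2)\<bar>" if "z \<in> S" for z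
    proof -
      have "\<bar>w z\<bar> \<le> C" using C that closure_subset by blast
      moreover have "\<bar>f z\<bar> \<le> 1 + (f z)\<^sup>2"
        using sum_squares_bound[of 1 "\<bar>f z\<bar>"] by simp
      ultimately have "\<bar>f z\<bar> * \<bar>w z\<bar> \<le> (1 + (f z)\<^sup>2) * C" by (intro mult_mono) auto
      then show ?thesis by (simp add: abs_mult mult.commute) (smt (verit) \<open>\<bar>w z\<bar> \<le> C\<close>)
    qed
    then show "AE x in lborel. norm (indicat_real S x *\<^sub>R (f x * w x))
        \<le> norm (indicat_real S x *\<^sub>R (C * (1 + (f x)\<^sup>2)))"
      by (intro AE_I2) (auto simp: indicator_def)
  qed
qed

text \<open>Extension by zero puts a control, which is square integrable only over its own region,
  on the same domain as the state.\<close>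

lemma L2_on_indicator_fst:
  fixes f :: "real \<times> real \<Rightarrow> real"
  assumes "L2_on (U \<times> I) f" "open U" "U \<subseteq> J"
  shows "L2_on (J \<times> I) (\<lambda>z. indicator U (fst z) * f z)"
proof -
  have [measurable]: "U \<in> sets borel" using assms by auto
  have [measurable]: "f \<in> borel_measurable borel" using assms by (simp add: L2_on_def)
  have "(\<lambda>z. indicator (J \<times> I) z *\<^sub>R (indicator U (fst z) * f z)\<^sup>2)
      = (\<lambda>z. indicator (U \<times> I) z *\<^sub>R (f z)\<^sup>2)"
    using assms(3) by (auto simp: indicator_def fun_eq_iff)
  moreover have "(\<lambda>z. indicator U (fst z) * f z) \<in> borel_measurable borel"
  proof (rule borel_measurable_times)
    have "fst \<in> borel_measurable (borel :: (real \<times> real) measure)"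
      by (intro borel_measurable_continuous_onI continuous_intros)
    moreover have "(indicator U :: real \<Rightarrow> real) \<in> borel_measurable borel"
      by simp
    ultimately show "(\<lambda>z::real \<times> real. indicator U (fst z) :: real) \<in> borel_measurable borel"
      by (rule measurable_compose)
  qed simp
  ultimately show ?thesis
    using assms(1) by (simp add: L2_on_def set_integrable_def)
qed

section \<open>Testing the system with travelling waves\<close>

text \<open>This is the sum of the three weak equations for the waves with profiles S'', S' and S.
  The bounds on \<open>\<alpha>\<close> and \<open>\<beta>\<close> keep the moving support inside
  (0,L) up to time T, and \<open>avoid\<close> keeps it off \<open>O1\<close>, which removes
  \<open>f\<close>. The coefficients remove \<open>rho\<close>, and zero initial velocity and
  temperature leave \<open>rho0\<close> as the only datum.\<close>

lemma weak_null_solution_wave_identity: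
  fixes L rb vb thb R cv kap mu lam T :: real
  assumes pos: "rb > 0" "vb > 0" "R > 0" "lam + 2 * mu > 0" "T > 0"
    and O2: "open O2" "O2 \<subseteq> {0<..<L}" and O3: "open O3" "O3 \<subseteq> {0<..<L}"
    and L2: "L2_on ({0<..<L} \<times> {0<..<T}) rho" "L2_on ({0<..<L} \<times> {0<..<T}) u"
      "L2_on ({0<..<L} \<times> {0<..<T}) th" "L2_on (O2 \<times> {0<..<T}) g" "L2_on (O3 \<times> {0<..<T}) h"
    and sol: "weak_null_solution L rb vb thb R cv kap mu lam O1 O2 O3 T
      rho0 (\<lambda>x. 0) (\<lambda>x. 0) f g h rho u th"
    and S: "\<And>x. (S has_real_derivative S1 x) (at x)" "\<And>x. (S1 has_real_derivative S2 x) (at x)"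
      "\<And>x. (S2 has_real_derivative S3 x) (at x)" "\<And>x. (S3 has_real_derivative S4 x) (at x)"
      "continuous_on UNIV S4"
    and supp: "\<And>x. x < \<alpha> \<or> x > \<beta> \<Longrightarrow> S x = 0 \<and> S1 x = 0 \<and> S2 x = 0"
    and \<alpha>\<beta>: "0 < \<alpha>" "\<beta> + vb * T < L"
    and avoid: "\<And>x t. \<alpha> \<le> x \<Longrightarrow> x \<le> \<beta> \<Longrightarrow> 0 < t \<Longrightarrow> t < T \<Longrightarrow> x + vb * t \<notin> O1"
    and nu: "nu = (lam + 2 * mu) / rb" and k: "k = kap / (rb * cv)" and a: "a = R * thb / nu"
  shows "set_lebesgue_integral lborel ({0<..<L} \<times> {0<..<T}) (\<lambda>(x,t). exp (a * t) *
        ((R * thb / cv - k / R * a) * u (x,t) * S1 (x - vb * t) + a * th (x,t) * S (x - vb * t)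
        - k / R * (indicator O2 x * g (x,t)) * S1 (x - vb * t)
        + indicator O3 x * h (x,t) * S (x - vb * t)))
    + nu * k / (rb * R) * set_lebesgue_integral lborel {0<..<L} (\<lambda>x. rho0 x * S2 x) = 0"
proof -
  define Q where "Q = {0<..<L} \<times> {0<..<T}"
  define A where "A = nu * k / (rb * R)"
  \<comment> \<open>With this choice \<open>vb * d\<close> is half of the smaller gap between the
    moving support and the boundary, so the support stays inside (0,L) even for times in
    [-d, T + d].\<close>
  define d where "d = min \<alpha> (L - vb * T - \<beta>) / (2 * vb)"
  have d: "d > 0" using \<alpha>\<beta> pos by (simp add: d_def)
  have vd: "vb * d < \<alpha>" "\<beta> + vb * (T + d) < L"
  proof -
    have "vb * d = min \<alpha> (L - vb * T - \<beta>) / 2" using pos by (simp add: d_def)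
    then show "vb * d < \<alpha>" "\<beta> + vb * (T + d) < L"
      using \<alpha>\<beta> by (auto simp: distrib_left min_def split: if_splits)
  qed
  \<comment> \<open>The test functions must satisfy the boundary conditions for all real \<open>t\<close>, but the waves cross
    the boundary outside \<open>[0,T]\<close>; hence the cutoff in time.\<close>
  obtain c c' where c: "\<And>t. (c has_real_derivative c' t) (at t)" "continuous_on UNIV c'"
    and c1: "\<And>t. 0 \<le> t \<Longrightarrow> t \<le> T \<Longrightarrow> c t = 1 \<and> c' t = 0"
    and c0: "\<And>t. t \<le> - d \<or> T + d \<le> t \<Longrightarrow> c t = 0"
    using exists_C1_cutoff[OF d \<open>T > 0\<close>] by blast
  \<comment> \<open>At x = 0 and x = L the profile is evaluated at \<open>- (vb * t)\<close> and
    \<open>L - vb * t\<close>. Both points lie outside [\<alpha>, \<beta>] as long as the cutoff is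
    nonzero.\<close>
  have bdry: "c t = 0 \<or> (- (vb * t) < \<alpha> \<and> L - vb * t > \<beta>)" for t
  proof (cases "t \<le> - d \<or> T + d \<le> t")
    case False
    then have "vb * (- t) < vb * d" "vb * t < vb * (T + d)"
      using pos(2) by (simp_all only: mult_less_cancel_left_pos) auto
    then show ?thesis using vd by linarith
  qed (use c0 in auto)
  have bdry0: "c t = 0 \<or> S (- (vb * t)) = 0" "c t = 0 \<or> S1 (- (vb * t)) = 0"
    "c t = 0 \<or> S (L - vb * t) = 0" "c t = 0 \<or> S1 (L - vb * t) = 0" "c t = 0 \<or> S2 (L - vb * t) = 0" for t
    using bdry[of t] supp by blast+

  define W where "W F z = exp (a * snd z) * F (fst z - vb * snd z)" for F and z :: "real \<times> real"
  have contS: "continuous_on UNIV S" "continuous_on UNIV S1" "continuous_on UNIV S2" "continuous_on UNIV S3"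
    using S by (meson DERIV_isCont continuous_at_imp_continuous_on)+
  have contW: "continuous_on UNIV (W F)" if "continuous_on UNIV F" for F
    unfolding W_def[abs_def]
    by (auto intro!: continuous_on_compose2[OF that] continuous_intros)
  define G where "G z = indicator O2 (fst z) * g z" for z
  define H where "H z = indicator O3 (fst z) * h z" for z
  have L2Q: "L2_on Q rho" "L2_on Q u" "L2_on Q th" "L2_on Q G" "L2_on Q H"
    using L2 L2_on_indicator_fst[OF L2(4) O2] L2_on_indicator_fst[OF L2(5) O3]
    by (simp_all add: Q_def G_def[abs_def] H_def[abs_def])
  have Qset: "bounded Q" "Q \<in> sets borel"
    by (auto simp: Q_def intro!: bounded_Times borel_open open_Times)
  have int: "set_integrable lborel Q (\<lambda>z. F z * W Z z)" if "L2_on Q F" "continuous_on UNIV Z" for F Z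
    by (rule L2_on_times_continuous_integrable[OF that(1) contW[OF that(2)] Qset])
  note ints = int[OF L2Q(1) contS(3)] int[OF L2Q(2) contS(2)] int[OF L2Q(2) contS(4)]
    int[OF L2Q(3) contS(1)] int[OF L2Q(3) contS(3)] int[OF L2Q(4) contS(2)] int[OF L2Q(5) contS(1)]

  \<comment> \<open>\<open>F1\<close>, \<open>F2\<close>, \<open>F3\<close> are the integrands of
    the three equations on \<open>Q\<close>, where c = 1 and c' = 0. They are written as
    combinations of the integrable products in \<open>ints\<close>, because adding the three
    integrals later requires each integrand to be integrable.\<close>
  define F1 where "F1 z = A * a * (rho z * W S2 z) + rb * A * (u z * W S3 z)" for z
  define F2 where "F2 z = - (k / R) * a * (u z * W S1 z) - k / R * nu * (u z * W S3 z)
      - R * thb / rb * (k / R) * (rho z * W S2 z) - k * (th z * W S2 z)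
      - k / R * (G z * W S1 z)" for z
  define F3 where "F3 z = a * (th z * W S z) + k * (th z * W S2 z)
      + R * thb / cv * (u z * W S1 z) + H z * W S z" for z
  have iF: "set_integrable lborel Q F1" "set_integrable lborel Q F2" "set_integrable lborel Q F3"
    unfolding F1_def[abs_def] F2_def[abs_def] F3_def[abs_def]
    by (intro set_integral_add set_integral_diff set_integrable_mult_right ints)+
  have Qm: "Q \<in> sets lborel" using Qset by simp

  let ?p = "\<lambda>K P (x,t). K * c t * exp (a * t) * P (x - vb * t)"
  let ?pt = "\<lambda>K P P1 (x,t). K * exp (a * t) * ((c' t + a * c t) * P (x - vb * t) - vb * c t * P1 (x - vb * t))"
  have tests: "test_fun (?p K S2) (?pt K S2 S3) (?p K S3) (?p K S4)"
    "test_fun (?p K S1) (?pt K S1 S2) (?p K S2) (?p K S3)"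
    "test_fun (?p K S) (?pt K S S1) (?p K S1) (?p K S2)" for K
    by (rule test_fun_travelling_wave[OF c]; use S contS in auto)+

  have p0: "\<forall>t. ?p A S2 (L, t) = 0"
    using bdry0(5) by auto
  have q0: "\<forall>t. ?p (- (k / R)) S1 (0, t) = 0 \<and> ?p (- (k / R)) S1 (L, t) = 0"
    using bdry0(2,4) by auto
  have r0: "\<forall>t. ?p 1 S (0, t) = 0 \<and> ?p 1 S (L, t) = 0"
    using bdry0(1,3) by auto
  \<comment> \<open>If the foot x - vb t of the characteristic lies in [\<alpha>, \<beta>], then x
    is outside \<open>O1\<close> by \<open>avoid\<close>; otherwise S'' vanishes at the
    foot.\<close>
  have O1_zero: "indicator O1 x * S2 (x - vb * t) = 0" if "(x, t) \<in> Q" for x t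
  proof (cases "\<alpha> \<le> x - vb * t \<and> x - vb * t \<le> \<beta>")
    case True
    then show ?thesis using that avoid[of "x - vb * t" t] by (simp add: Q_def)
  next
    case False
    then have "S2 (x - vb * t) = 0" using supp[of "x - vb * t"] by linarith
    then show ?thesis by simp
  qed

  have "set_lebesgue_integral lborel Q (\<lambda>(x,t).
      rho (x,t) * (?pt A S2 S3 (x,t) + vb * ?p A S3 (x,t)) + rb * u (x,t) * ?p A S3 (x,t)
      + indicator O1 x * f (x,t) * ?p A S2 (x,t))
    + set_lebesgue_integral lborel {0<..<L} (\<lambda>x. rho0 x * ?p A S2 (x, 0)) = 0"
    (is "set_lebesgue_integral lborel Q ?E1 + _ = 0")
    using sol tests(1)[of A] p0 unfolding weak_null_solution_def Let_def Q_def by blast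
  moreover have "set_lebesgue_integral lborel Q ?E1 = set_lebesgue_integral lborel Q F1"
  proof (rule set_lebesgue_integral_cong[OF Qm], intro allI impI)
    fix z assume z: "z \<in> Q"
    obtain x t where zxt: "z = (x, t)" by fastforce
    have "c t = 1" "c' t = 0" using c1 z by (auto simp: Q_def zxt)
    then show "?E1 z = F1 z"
      using O1_zero[of x t] z by (auto simp: zxt F1_def W_def algebra_simps)
  qed
  moreover have "set_lebesgue_integral lborel {0<..<L} (\<lambda>x. rho0 x * ?p A S2 (x, 0))
      = A * set_lebesgue_integral lborel {0<..<L} (\<lambda>x. rho0 x * S2 x)"
    using c1[of 0] pos(5) by (simp add: mult_ac flip: set_integral_mult_right)
  ultimately have e1: "set_lebesgue_integral lborel Q F1
      + A * set_lebesgue_integral lborel {0<..<L} (\<lambda>x. rho0 x * S2 x) = 0" by simp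

  have "set_lebesgue_integral lborel Q (\<lambda>(x,t).
      u (x,t) * (?pt (- (k / R)) S1 S2 (x,t) + ((lam + 2 * mu) / rb) * ?p (- (k / R)) S3 (x,t)
        + vb * ?p (- (k / R)) S2 (x,t))
      + (R * thb / rb) * rho (x,t) * ?p (- (k / R)) S2 (x,t) + R * th (x,t) * ?p (- (k / R)) S2 (x,t)
      + indicator O2 x * g (x,t) * ?p (- (k / R)) S1 (x,t))
    + set_lebesgue_integral lborel {0<..<L} (\<lambda>x. 0 * ?p (- (k / R)) S1 (x, 0)) = 0"
    (is "set_lebesgue_integral lborel Q ?E2 + _ = 0")
    using sol tests(2)[of "- (k / R)"] q0 unfolding weak_null_solution_def Let_def Q_def by blast
  moreover have "set_lebesgue_integral lborel Q ?E2 = set_lebesgue_integral lborel Q F2"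
  proof (rule set_lebesgue_integral_cong[OF Qm], intro allI impI)
    fix z assume z: "z \<in> Q"
    obtain x t where zxt: "z = (x, t)" by fastforce
    have "c t = 1" "c' t = 0" using c1 z by (auto simp: Q_def zxt)
    then show "?E2 z = F2 z"
      using pos(3) by (simp add: zxt F2_def W_def G_def flip: nu) (simp add: algebra_simps diff_divide_distrib)
  qed
  ultimately have e2: "set_lebesgue_integral lborel Q F2 = 0"
    by (simp add: set_lebesgue_integral_def)

  have "set_lebesgue_integral lborel Q (\<lambda>(x,t).
      th (x,t) * (?pt 1 S S1 (x,t) + (kap / (rb * cv)) * ?p 1 S2 (x,t) + vb * ?p 1 S1 (x,t))
      + (R * thb / cv) * u (x,t) * ?p 1 S1 (x,t) + indicator O3 x * h (x,t) * ?p 1 S (x,t))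
    + set_lebesgue_integral lborel {0<..<L} (\<lambda>x. 0 * ?p 1 S (x, 0)) = 0"
    (is "set_lebesgue_integral lborel Q ?E3 + _ = 0")
    using sol tests(3)[of 1] r0 unfolding weak_null_solution_def Let_def Q_def by blast
  moreover have "set_lebesgue_integral lborel Q ?E3 = set_lebesgue_integral lborel Q F3"
  proof (rule set_lebesgue_integral_cong[OF Qm], intro allI impI)
    fix z assume z: "z \<in> Q"
    obtain x t where zxt: "z = (x, t)" by fastforce
    have "c t = 1" "c' t = 0" using c1 z by (auto simp: Q_def zxt)
    then show "?E3 z = F3 z"
      by (simp add: zxt F3_def W_def H_def flip: k) (simp add: algebra_simps)
  qed
  ultimately have e3: "set_lebesgue_integral lborel Q F3 = 0"
    by (simp add: set_lebesgue_integral_def)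

  \<comment> \<open>The first identity cancels the terms in u S''' and determines \<open>A\<close>;
    the second cancels those in rho S'' and determines \<open>a\<close>. The terms in th S'' have
    the opposite coefficients - k and k.\<close>
  have coeff: "rb * A = k / R * nu" "A * a = R * thb / rb * (k / R)"
    using pos by (auto simp: A_def a nu mult.commute)
  have "set_lebesgue_integral lborel Q (\<lambda>(x,t). exp (a * t) *
        ((R * thb / cv - k / R * a) * u (x,t) * S1 (x - vb * t) + a * th (x,t) * S (x - vb * t)
        - k / R * (indicator O2 x * g (x,t)) * S1 (x - vb * t)
        + indicator O3 x * h (x,t) * S (x - vb * t)))
      = set_lebesgue_integral lborel Q (\<lambda>z. F1 z + F2 z + F3 z)"
    by (rule set_lebesgue_integral_cong[OF Qm])
      (auto simp: F1_def F2_def F3_def coeff, auto simp: W_def G_def H_def algebra_simps)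
  also have "\<dots> = set_lebesgue_integral lborel Q F1"
    using iF e2 e3 by (simp add: set_integral_add)
  finally show ?thesis
    using e1 by (simp add: Q_def A_def)
qed

section \<open>Integrals against concentrating waves\<close>

lemma set_integrable_times_bounded_wave:
  fixes F :: "real \<times> real \<Rightarrow> real" and \<phi> :: "real \<Rightarrow> real"
  assumes F: "set_integrable lborel Q F"
    and meas: "\<phi> \<in> borel_measurable borel" and bound: "\<And>x. \<bar>\<phi> x\<bar> \<le> C"
  shows "set_integrable lborel Q (\<lambda>z. F z * \<phi> (fst z - v * snd z))"
proof -
  have "(\<lambda>z. fst z - v * snd z) \<in> borel_measurable (borel :: (real \<times> real) measure)"
    by (intro borel_measurable_continuous_onI continuous_intros)
  then have wave: "(\<lambda>z. \<phi> (fst z - v * snd z)) \<in> borel_measurable lborel"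
    using measurable_compose[OF _ meas] by simp
  let ?F = "\<lambda>z. indicator Q z *\<^sub>R F z"
  have int: "integrable lborel ?F" using F by (simp add: set_integrable_def)
  have "integrable lborel (\<lambda>z. \<phi> (fst z - v * snd z) * ?F z)"
  proof (rule Bochner_Integration.integrable_bound)
    show "integrable lborel (\<lambda>z. C * ?F z)"
      using int by (rule integrable_mult_right)
    show "(\<lambda>z. \<phi> (fst z - v * snd z) * ?F z) \<in> borel_measurable lborel"
      using wave borel_measurable_integrable[OF int] by (rule borel_measurable_times)
    have "\<bar>\<phi> x\<bar> \<le> \<bar>C\<bar>" for x
      using bound[of x] by linarith
    then show "AE z in lborel. norm (\<phi> (fst z - v * snd z) * ?F z) \<le> norm (C * ?F z)"
      by (intro AE_I2) (simp only: real_norm_def abs_mult mult_right_mono abs_ge_zero)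
  qed
  then show ?thesis by (simp add: set_integrable_def mult_ac)
qed

text \<open>Dominated convergence with majorant C |F|. Pointwise convergence can fail only on the
  characteristic through x0, a line with normal (1, -v) and hence a null set of the plane.\<close>

lemma concentrating_wave_integral_tendsto_0:
  fixes F :: "real \<times> real \<Rightarrow> real" and \<phi> :: "nat \<Rightarrow> real \<Rightarrow> real"
  assumes F: "set_integrable lborel Q F"
    and meas: "\<And>n. \<phi> n \<in> borel_measurable borel" and bound: "\<And>n x. \<bar>\<phi> n x\<bar> \<le> C"
    and lim: "\<And>x. x \<noteq> x0 \<Longrightarrow> (\<lambda>n. \<phi> n x) \<longlonglongrightarrow> 0"
  shows "(\<lambda>n. set_lebesgue_integral lborel Q (\<lambda>z. F z * \<phi> n (fst z - v * snd z))) \<longlonglongrightarrow> 0"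
proof -
  let ?F = "\<lambda>z. indicator Q z *\<^sub>R F z"
  have int: "integrable lborel ?F" using F by (simp add: set_integrable_def)
  have eq: "indicator Q z *\<^sub>R (F z * \<phi> n (fst z - v * snd z)) = ?F z * \<phi> n (fst z - v * snd z)" for z n
    by simp
  have null: "AE z in lborel. fst z - v * snd z \<noteq> x0"
  proof -
    have "negligible {z. (1 :: real, - v) \<bullet> z = x0}"
      by (rule negligible_hyperplane) (simp add: zero_prod_def)
    then have "AE z in lebesgue. z \<notin> {z. (1 :: real, - v) \<bullet> z = x0}"
      unfolding negligible_iff_null_sets by (rule AE_not_in)
    then show ?thesis
      by (subst (asm) AE_completion_iff) (auto simp: inner_prod_def)
  qed
  have "(\<lambda>n. \<integral>z. ?F z * \<phi> n (fst z - v * snd z) \<partial>lborel) \<longlonglongrightarrow> (\<integral>(z::real \<times> real). 0 \<partial>lborel)"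
  proof (rule integral_dominated_convergence)
    show "integrable lborel (\<lambda>z. \<bar>?F z\<bar> * C)"
      using int by (intro integrable_mult_left integrable_abs)
    show "(\<lambda>z. ?F z * \<phi> n (fst z - v * snd z)) \<in> borel_measurable lborel" for n
      using set_integrable_times_bounded_wave[OF F meas bound, of n v]
      by (simp only: set_integrable_def eq borel_measurable_integrable)
    show "AE z in lborel. (\<lambda>n. ?F z * \<phi> n (fst z - v * snd z)) \<longlonglongrightarrow> 0"
      using null by eventually_elim (auto intro!: tendsto_mult_right_zero lim)
    show "AE z in lborel. norm (?F z * \<phi> n (fst z - v * snd z)) \<le> \<bar>?F z\<bar> * C" for n
      by (intro AE_I2) (simp only: real_norm_def abs_mult, intro mult_left_mono bound, simp)
  qed simp
  then show ?thesis by (simp only: set_lebesgue_integral_def eq) simp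
qed

section \<open>A step density that cannot be controlled\<close>

theorem theorem1p4:
  fixes L rb vb thb R cv kap mu lam l1 l2 T :: real
    and O2 O3 :: "real set"
  assumes "L > 0" and "rb > 0" and "vb > 0" and "thb > 0" and "R > 0" and "cv > 0"
    and "kap > 0" and "mu > 0" and "lam + mu \<ge> 0"
    and "0 \<le> l1" and "l1 < l2" and "l2 \<le> L" and "\<not> (l1 = 0 \<and> l2 = L)"
    and "open O2" and "O2 \<subseteq> {0<..<L}" and "open O3" and "O3 \<subseteq> {0<..<L}"
    and "T > 0" and "T < max (l1 / vb) ((L - l2) / vb)"
  shows "\<not> null_controllable L rb vb thb R cv kap mu lam {l1<..<l2} O2 O3 T"
proof
  assume nc: "null_controllable L rb vb thb R cv kap mu lam {l1<..<l2} O2 O3 T"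
  have vT: "vb * T > 0" using assms by simp
  \<comment> \<open>The interval (p,q) consists of starting points whose characteristics miss the
    control region. In the first case they start in (0, l1 - vb T) and stay left of l1; in the
    second they start in (l2, L - vb T), stay right of l2 and do not leave (0,L) by time T.\<close>
  obtain p q where pq: "0 \<le> p" "p < q" "q + vb * T \<le> L"
    and avoid: "\<And>x t. p < x \<Longrightarrow> x < q \<Longrightarrow> 0 < t \<Longrightarrow> t < T \<Longrightarrow> x + vb * t \<notin> {l1<..<l2}"
  proof (cases "T < l1 / vb")
    case True
    show thesis
    proof (rule that[of 0 "l1 - vb * T"])
      show "0 < l1 - vb * T" using True assms by (simp add: field_simps)
      show "x + vb * t \<notin> {l1<..<l2}" if "0 < x" "x < l1 - vb * T" "0 < t" "t < T" for x t
        using mult_strict_left_mono[OF that(4) \<open>vb > 0\<close>] that by auto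
    qed (use assms in auto)
  next
    case False
    then have "T < (L - l2) / vb" using assms by linarith
    then have "vb * T < L - l2" using assms by (simp add: field_simps)
    show thesis
    proof (rule that[of l2 "L - vb * T"])
      show "x + vb * t \<notin> {l1<..<l2}" if "l2 < x" "x < L - vb * T" "0 < t" "t < T" for x t
        using mult_pos_pos[OF \<open>vb > 0\<close> that(3)] that by auto
    qed (use \<open>vb * T < L - l2\<close> assms in auto)
  qed
  \<comment> \<open>A quarter of the length, rather than half, puts the closed interval
    [x0 - e, x0 + e] inside the open interval (p,q).\<close>
  define x0 e where "x0 = (p + q) / 2" and "e = (q - p) / 4"
  have e: "e > 0" "p < x0 - e" "x0 + e < q"
    using pq by (auto simp: x0_def e_def field_simps)
  define rho0 :: "real \<Rightarrow> real" where "rho0 = indicator {..x0}"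
  have "L2_on {0<..<L} rho0"
  proof -
    have "(\<lambda>x. indicator {0<..<L} x *\<^sub>R (rho0 x)\<^sup>2) = indicat_real ({0<..<L} \<inter> {..x0})"
      by (auto simp: rho0_def indicator_def fun_eq_iff)
    moreover have "emeasure lborel ({0<..<L} \<inter> {..x0}) < \<infinity>"
      by (rule emeasure_bounded_finite) (auto intro: bounded_Int)
    ultimately show ?thesis
      by (simp add: L2_on_def set_integrable_def) (simp add: rho0_def)
  qed
  moreover have "L2_on {0<..<L} (\<lambda>x. 0)"
    by (simp add: L2_on_def set_integrable_def)
  \<comment> \<open>Controls and state are fixed here, before the bumps are chosen. The limit below
    therefore concerns fixed integrands.\<close>
  ultimately obtain f g h rho u th
    where L2: "L2_on (O2 \<times> {0<..<T}) g" "L2_on (O3 \<times> {0<..<T}) h"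
      "L2_on ({0<..<L} \<times> {0<..<T}) rho" "L2_on ({0<..<L} \<times> {0<..<T}) u"
      "L2_on ({0<..<L} \<times> {0<..<T}) th"
    and sol: "weak_null_solution L rb vb thb R cv kap mu lam {l1<..<l2} O2 O3 T
      rho0 (\<lambda>x. 0) (\<lambda>x. 0) f g h rho u th"
    using nc unfolding null_controllable_def by blast

  obtain B B1 B2 B3 B4 :: "real \<Rightarrow> real"
    where B: "\<And>x. (B has_real_derivative B1 x) (at x)" "\<And>x. (B1 has_real_derivative B2 x) (at x)"
      "\<And>x. (B2 has_real_derivative B3 x) (at x)" "\<And>x. (B3 has_real_derivative B4 x) (at x)"
      "continuous_on UNIV B4"
    and B0: "\<And>x. \<bar>x\<bar> \<ge> 1 \<Longrightarrow> B x = 0 \<and> B1 x = 0 \<and> B2 x = 0 \<and> B3 x = 0 \<and> B4 x = 0"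
    and B1: "B1 0 = 1"
    using exists_C4_odd_bump by blast
  have contB: "continuous_on UNIV B" "continuous_on UNIV B1" "continuous_on UNIV B2"
    using B by (meson DERIV_isCont continuous_at_imp_continuous_on)+
  \<comment> \<open>The bound \<epsilon> \<le> e keeps all the rescaled bumps supported in
    [x0 - e, x0 + e].\<close>
  define \<epsilon> where "\<epsilon> n = e / real (Suc n)" for n
  have \<epsilon>: "\<epsilon> n > 0" "\<epsilon> n \<le> e" for n
    using e by (auto simp: \<epsilon>_def field_simps)
  have \<epsilon>_lim: "\<epsilon> \<longlonglongrightarrow> 0"
    unfolding \<epsilon>_def[abs_def] by (rule LIMSEQ_Suc[OF lim_const_over_n])
  \<comment> \<open>Only the argument is rescaled. The profile is S =
    \<open>\<epsilon> n * Z B n\<close>, so that S' = \<open>Z B1 n\<close> stays bounded, equals 1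
    at x0, and S'' = \<open>Z B2 n x / \<epsilon> n\<close>.\<close>
  define Z where "Z F n x = F ((x - x0) / \<epsilon> n)" for F :: "real \<Rightarrow> real" and n x
  have Z_cont: "continuous_on UNIV (Z F n)" if "continuous_on UNIV F" for F n
    unfolding Z_def[abs_def] using \<epsilon>(1)[of n]
    by (intro continuous_on_compose2[OF that] continuous_intros) auto
  have Z_deriv: "(Z F n has_real_derivative Z F' n x / \<epsilon> n) (at x)"
    if "\<And>x. (F has_real_derivative F' x) (at x)" for F F' n x
  proof -
    have "((\<lambda>x. F ((x - x0) / \<epsilon> n)) has_real_derivative F' ((x - x0) / \<epsilon> n) * (1 / \<epsilon> n)) (at x)"
      by (rule DERIV_chain2[OF that]) (use \<epsilon>(1)[of n] in \<open>auto intro!: derivative_eq_intros\<close>)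
    then show ?thesis by (simp add: Z_def[abs_def])
  qed
  have far: "1 \<le> \<bar>(x - x0) / \<epsilon> n\<bar>" if "\<epsilon> n \<le> \<bar>x - x0\<bar>" for n x
    using that \<epsilon>(1)[of n] by (simp add: abs_divide)
  have Z_far: "Z B n x = 0 \<and> Z B1 n x = 0 \<and> Z B2 n x = 0" if "x < x0 - e \<or> x > x0 + e" for n x
    using B0[OF far[of n x]] that \<epsilon>[of n] by (auto simp: Z_def abs_if)
  \<comment> \<open>The shrinking support eventually leaves every x different from x0. The exception
    is genuine, as \<open>Z B1 n x0\<close> is 1 for all n.\<close>
  have Z_lim: "(\<lambda>n. Z F n x) \<longlonglongrightarrow> 0" if F: "F = B \<or> F = B1" and x: "x \<noteq> x0" for F x
  proof (rule tendsto_eventually)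
    have "eventually (\<lambda>n. \<epsilon> n < \<bar>x - x0\<bar>) sequentially"
      using \<epsilon>_lim x by (intro order_tendstoD(2)) auto
    then show "eventually (\<lambda>n. Z F n x = 0) sequentially"
      by eventually_elim (use B0 far F in \<open>auto simp: Z_def\<close>)
  qed
  have bounded: "\<exists>C. \<forall>x. \<bar>F x\<bar> \<le> C"
    if "continuous_on UNIV F" "\<And>x. \<bar>x\<bar> \<ge> 1 \<Longrightarrow> F x = 0" for F :: "real \<Rightarrow> real"
  proof -
    have "compact (F ` {-1..1})"
      by (intro compact_continuous_image continuous_on_subset[OF that(1)]) auto
    then obtain C where C: "\<forall>x\<in>{-1..1}. \<bar>F x\<bar> \<le> C"
      by (force dest!: compact_imp_bounded simp: bounded_iff)
    have "\<bar>F x\<bar> \<le> max C 0" for x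
    proof (cases "x \<in> {-1..1}")
      case True
      then show ?thesis using C by force
    next
      case False
      then have "F x = 0" by (intro that(2)) auto
      then show ?thesis by simp
    qed
    then show ?thesis by blast
  qed
  obtain C C1 where C: "\<And>x. \<bar>B x\<bar> \<le> C" "\<And>x. \<bar>B1 x\<bar> \<le> C1"
    using bounded[of B] bounded[of B1] contB B0 by blast

  define nu k where "nu = (lam + 2 * mu) / rb" and "k = kap / (rb * cv)"
  define a where "a = R * thb / nu"
  have nu: "nu > 0" and k: "k > 0" using assms by (auto simp: nu_def k_def)
  define Q where "Q = {0<..<L} \<times> {0<..<T}"
  \<comment> \<open>\<open>G\<close> and \<open>H\<close> collect the factors of S' and S in the
    wave identity; neither depends on n.\<close>
  define G where "G z = exp (a * snd z) * ((R * thb / cv - k / R * a) * u z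
    - k / R * (indicator O2 (fst z) * g z))" for z
  define H where "H z = exp (a * snd z) * (a * th z + indicator O3 (fst z) * h z)" for z
  have intQ: "set_integrable lborel Q (\<lambda>z. F z * exp (a * snd z))" if "L2_on Q F" for F
    by (rule L2_on_times_continuous_integrable[OF that])
      (auto simp: Q_def intro!: continuous_intros bounded_Times borel_open open_Times)
  have L2Q: "L2_on Q u" "L2_on Q th" "L2_on Q (\<lambda>z. indicator O2 (fst z) * g z)"
    "L2_on Q (\<lambda>z. indicator O3 (fst z) * h z)"
    using L2 L2_on_indicator_fst[OF L2(1) assms(14,15)] L2_on_indicator_fst[OF L2(2) assms(16,17)]
    by (simp_all add: Q_def)
  have "set_integrable lborel Q (\<lambda>z. (R * thb / cv - k / R * a) * (u z * exp (a * snd z))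
      - k / R * (indicator O2 (fst z) * g z * exp (a * snd z)))"
    by (intro set_integral_diff set_integrable_mult_right intQ L2Q)
  then have G_int: "set_integrable lborel Q G"
    by (simp add: G_def[abs_def] algebra_simps)
  have "set_integrable lborel Q (\<lambda>z. a * (th z * exp (a * snd z))
      + indicator O3 (fst z) * h z * exp (a * snd z))"
    by (intro set_integral_add set_integrable_mult_right intQ L2Q)
  then have H_int: "set_integrable lborel Q H"
    by (simp add: H_def[abs_def] algebra_simps)

  define J where "J n = set_lebesgue_integral lborel Q (\<lambda>z. G z * Z B1 n (fst z - vb * snd z))" for n
  define K where "K n = set_lebesgue_integral lborel Q (\<lambda>z. H z * Z B n (fst z - vb * snd z))" for n
  have J_lim: "J \<longlonglongrightarrow> 0"
    unfolding J_def[abs_def]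
    by (rule concentrating_wave_integral_tendsto_0[OF G_int, of _ C1 x0])
      (use contB C Z_lim in \<open>auto simp: Z_def[symmetric] intro!: borel_measurable_continuous_onI Z_cont,
        auto simp: Z_def\<close>)
  have K_lim: "K \<longlonglongrightarrow> 0"
    unfolding K_def[abs_def]
    by (rule concentrating_wave_integral_tendsto_0[OF H_int, of _ C x0])
      (use contB C Z_lim in \<open>auto simp: Z_def[symmetric] intro!: borel_measurable_continuous_onI Z_cont,
        auto simp: Z_def\<close>)
  have identity: "J n + \<epsilon> n * K n + nu * k / (rb * R) = 0" for n
  proof -
    let ?S = "\<lambda>x. \<epsilon> n * Z B n x" and ?S2 = "\<lambda>x. Z B2 n x / \<epsilon> n"
    have S: "(?S has_real_derivative Z B1 n x) (at x)" "(Z B1 n has_real_derivative ?S2 x) (at x)"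
      "(?S2 has_real_derivative Z B3 n x / \<epsilon> n / \<epsilon> n) (at x)"
      "((\<lambda>x. Z B3 n x / \<epsilon> n / \<epsilon> n) has_real_derivative Z B4 n x / \<epsilon> n / \<epsilon> n / \<epsilon> n) (at x)" for x
    proof -
      show "(?S has_real_derivative Z B1 n x) (at x)"
        using DERIV_cmult[OF Z_deriv[OF B(1)], of "\<epsilon> n" n x] \<epsilon>(1)[of n] by simp
    qed (intro DERIV_cdivide Z_deriv B)+
    have meas_int: "set_lebesgue_integral lborel {0<..<L} (\<lambda>x. rho0 x * ?S2 x) = 1"
    proof -
      \<comment> \<open>The bump is supported to the right of 0, so the integrand may be taken over
        the closed interval [0, x0]. The fundamental theorem of calculus then yields S'(x0) - S'(0)
        = 1 - 0.\<close>
      have S2_0: "Z B2 n x = 0" if "x \<le> 0" for x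
        using Z_far[of x n] that e pq by auto
      have x0: "0 \<le> x0" "x0 < L" using e pq vT by auto
      have "set_lebesgue_integral lborel {0<..<L} (\<lambda>x. rho0 x * ?S2 x)
          = (\<integral>x. ?S2 x * indicator {0..x0} x \<partial>lborel)"
        unfolding set_lebesgue_integral_def
        by (rule Bochner_Integration.integral_cong)
          (use S2_0 x0 in \<open>auto simp: rho0_def indicator_def\<close>)
      also have "\<dots> = Z B1 n x0 - Z B1 n 0"
        by (rule integral_FTC_Icc_real[OF x0(1) S(2)]) (use S(3) DERIV_isCont in blast)
      also have "\<dots> = 1"
        using Z_far[of 0 n] e pq B1 by (simp add: Z_def)
      finally show ?thesis .
    qed
    have "set_lebesgue_integral lborel ({0<..<L} \<times> {0<..<T}) (\<lambda>(x,t). exp (a * t) *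
        ((R * thb / cv - k / R * a) * u (x,t) * Z B1 n (x - vb * t) + a * th (x,t) * ?S (x - vb * t)
        - k / R * (indicator O2 x * g (x,t)) * Z B1 n (x - vb * t)
        + indicator O3 x * h (x,t) * ?S (x - vb * t)))
      + nu * k / (rb * R) * set_lebesgue_integral lborel {0<..<L} (\<lambda>x. rho0 x * ?S2 x) = 0"
    proof (rule weak_null_solution_wave_identity[OF assms(2,3,5) _ assms(18,14-17) L2(3-5,1,2) sol S,
          where \<alpha> = "x0 - e" and \<beta> = "x0 + e"])
      show "continuous_on UNIV (\<lambda>x. Z B4 n x / \<epsilon> n / \<epsilon> n / \<epsilon> n)"
        using \<epsilon>(1)[of n] by (intro continuous_intros Z_cont B) auto
      show "x + vb * t \<notin> {l1<..<l2}" if "x0 - e \<le> x" "x \<le> x0 + e" "0 < t" "t < T" for x t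
        using avoid[of x t] that e by auto
    qed (use Z_far e pq assms in \<open>auto simp: nu_def k_def a_def\<close>)
    moreover have "set_lebesgue_integral lborel Q (\<lambda>(x,t). exp (a * t) *
        ((R * thb / cv - k / R * a) * u (x,t) * Z B1 n (x - vb * t) + a * th (x,t) * ?S (x - vb * t)
        - k / R * (indicator O2 x * g (x,t)) * Z B1 n (x - vb * t)
        + indicator O3 x * h (x,t) * ?S (x - vb * t))) = J n + \<epsilon> n * K n"
    proof -
      have "set_integrable lborel Q (\<lambda>z. G z * Z B1 n (fst z - vb * snd z))"
        by (rule set_integrable_times_bounded_wave[OF G_int, of _ C1])
          (use contB C in \<open>auto simp: Z_def intro!: borel_measurable_continuous_onI Z_cont[unfolded Z_def]\<close>)
      moreover have "set_integrable lborel Q (\<lambda>z. H z * Z B n (fst z - vb * snd z))"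
        by (rule set_integrable_times_bounded_wave[OF H_int, of _ C])
          (use contB C in \<open>auto simp: Z_def intro!: borel_measurable_continuous_onI Z_cont[unfolded Z_def]\<close>)
      ultimately have "set_lebesgue_integral lborel Q (\<lambda>z. G z * Z B1 n (fst z - vb * snd z)
          + \<epsilon> n * (H z * Z B n (fst z - vb * snd z))) = J n + \<epsilon> n * K n"
        unfolding J_def K_def by (subst set_integral_add) auto
      moreover have "(\<lambda>(x,t). exp (a * t) *
          ((R * thb / cv - k / R * a) * u (x,t) * Z B1 n (x - vb * t) + a * th (x,t) * ?S (x - vb * t)
          - k / R * (indicator O2 x * g (x,t)) * Z B1 n (x - vb * t)
          + indicator O3 x * h (x,t) * ?S (x - vb * t)))
        = (\<lambda>z. G z * Z B1 n (fst z - vb * snd z) + \<epsilon> n * (H z * Z B n (fst z - vb * snd z)))"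
        by (auto simp: fun_eq_iff G_def H_def algebra_simps)
      ultimately show ?thesis by simp
    qed
    ultimately show ?thesis
      unfolding meas_int Q_def[symmetric] by simp
  qed
  \<comment> \<open>The left-hand side is 0 for every n, whereas its limit is the positive
    contribution of the jump.\<close>
  have "(\<lambda>n. J n + \<epsilon> n * K n + nu * k / (rb * R)) \<longlonglongrightarrow> 0 + 0 * 0 + nu * k / (rb * R)"
    by (intro tendsto_intros J_lim K_lim \<epsilon>_lim)
  then have "nu * k / (rb * R) = 0"
    unfolding identity by (simp add: LIMSEQ_const_iff)
  then show False using nu k assms by simp
qed

end
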